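(* Let $G$ be a torsion free nilpotent group of class $2$, and let $\sqrt{G}$ be its Mal'tsev completion. Then $G$ and $\sqrt{G}$ are geometrically equivalent.
   Context: Geometric equivalence. Let $\Theta$ be a variety of groups and, for a finite set $X$, let $W(X)$ be the free group of $\Theta$ over $X$. For $G\in\Theta$ and $T\subset W(X)$ put $T'_G=\{\mu\in \mathrm{Hom}(W(X),G)\mid T\subset\ker\mu\}$ and $T''_G=\bigcap_{\mu\in T'_G}\ker\mu\subset W(X)$. Groups $G_1,G_2\in\Theta$ are geometrically equivalent ($G_1\sim G_2$) if $T''_{G_1}=T''_{G_2}$ for every finite set $X$ and every $T\subset W(X)$. (It is known that $G_1\sim G_2$ if and only if every finitely generated subgroup $H$ of $G_1$ is approximated by $G_2$, i.e. there is a family $\{\varphi_i\}_{i\in I}\subset\mathrm{Hom}(H,G_2)$ with $\bigcap_{i}\ker\varphi_i=\{1\}$, and vice versa; so the notion does not depend on the variety $\Theta$ containing both groups.) Mal'tsev completion. For a torsion free nilpotent group $G$, $\sqrt{G}$ is the minimal torsion free nilpotent group containing $G$ such that for every $x\in\sqrt{G}$ and every $n\in\mathbb{N}$, $n\ge 1$, there is a (unique) $x^{1/n}\in\sqrt{G}$ with $(x^{1/n})^n=x$. It is nilpotent of the same class as $G$. *)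

theory Defs
  imports "HOL-Algebra.Generated_Groups"
begin

section \<open>Free groups of a variety\<close>

text \<open>The letter \<open>(True, x)\<close> stands for \<open>x\<close> and \<open>(False, x)\<close> for \<open>x\<inverse>\<close>.\<close>

type_synonym 'x word = "(bool \<times> 'x) list"

definition inv_letter :: "bool \<times> 'x \<Rightarrow> bool \<times> 'x" where
  "inv_letter l = (\<not> fst l, snd l)"

fun cons_reduce :: "bool \<times> 'x \<Rightarrow> 'x word \<Rightarrow> 'x word" where
  "cons_reduce l [] = [l]"
| "cons_reduce l (m # w) = (if m = inv_letter l then w else l # m # w)"

definition free_group :: "'x set \<Rightarrow> 'x word monoid" where
  "free_group X =
     \<lparr>carrier = {w \<in> lists (UNIV \<times> X). successively (\<lambda>l m. m \<noteq> inv_letter l) w},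
      mult = (\<lambda>u v. foldr cons_reduce u v),
      one = []\<rparr>"

fun word_val :: "('a, 'm) monoid_scheme \<Rightarrow> ('x \<Rightarrow> 'a) \<Rightarrow> 'x word \<Rightarrow> 'a" where
  "word_val G f [] = \<one>\<^bsub>G\<^esub>"
| "word_val G f ((b, x) # w) = (if b then f x else inv\<^bsub>G\<^esub> (f x)) \<otimes>\<^bsub>G\<^esub> word_val G f w"

text \<open>A variety of groups is given by a set \<open>\<Theta>\<close> of words over countably many variables; it consists
  of the groups satisfying the identity \<open>w = 1\<close> for every \<open>w \<in> \<Theta>\<close>. The case \<open>\<Theta> = {}\<close> is the
  variety of all groups.\<close>

definition in_variety :: "nat word set \<Rightarrow> ('a, 'm) monoid_scheme \<Rightarrow> bool" where
  "in_variety \<Theta> G \<longleftrightarrow>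
     group G \<and> (\<forall>w\<in>\<Theta>. \<forall>f \<in> UNIV \<rightarrow> carrier G. word_val G f w = \<one>\<^bsub>G\<^esub>)"

definition verbal_subgroup :: "nat word set \<Rightarrow> ('a, 'm) monoid_scheme \<Rightarrow> 'a set" where
  "verbal_subgroup \<Theta> G = generate G {word_val G f w | f w. w \<in> \<Theta> \<and> f \<in> UNIV \<rightarrow> carrier G}"

definition variety_free_group :: "nat word set \<Rightarrow> 'x set \<Rightarrow> 'x word set monoid" where
  "variety_free_group \<Theta> X = free_group X Mod verbal_subgroup \<Theta> (free_group X)"


section \<open>Geometric equivalence\<close>

definition killing_homs ::
    "('w, 'k) monoid_scheme \<Rightarrow> ('a, 'm) monoid_scheme \<Rightarrow> 'w set \<Rightarrow> ('w \<Rightarrow> 'a) set" where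
  "killing_homs W G T = {\<mu> \<in> hom W G. T \<subseteq> kernel W G \<mu>}"

definition geometric_closure ::
    "('w, 'k) monoid_scheme \<Rightarrow> ('a, 'm) monoid_scheme \<Rightarrow> 'w set \<Rightarrow> 'w set" where
  "geometric_closure W G T = (\<Inter>\<mu> \<in> killing_homs W G T. kernel W G \<mu>)"

text \<open>Finite sets of variables are taken inside \<open>nat\<close>; up to renaming these are all finite sets.\<close>

definition geometrically_equivalent ::
    "nat word set \<Rightarrow> ('a, 'm) monoid_scheme \<Rightarrow> ('b, 'n) monoid_scheme \<Rightarrow> bool" where
  "geometrically_equivalent \<Theta> G\<^sub>1 G\<^sub>2 \<longleftrightarrow>
     (\<forall>X :: nat set. finite X \<longrightarrow>
       (\<forall>T \<subseteq> carrier (variety_free_group \<Theta> X).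
          geometric_closure (variety_free_group \<Theta> X) G\<^sub>1 T =
          geometric_closure (variety_free_group \<Theta> X) G\<^sub>2 T))"


section \<open>Torsion free nilpotent groups and Mal'tsev completions\<close>

definition torsion_free :: "('a, 'm) monoid_scheme \<Rightarrow> bool" where
  "torsion_free G \<longleftrightarrow>
     (\<forall>x\<in>carrier G. \<forall>n::nat. n \<ge> 1 \<longrightarrow> x [^]\<^bsub>G\<^esub> n = \<one>\<^bsub>G\<^esub> \<longrightarrow> x = \<one>\<^bsub>G\<^esub>)"

text \<open>Indexed from 0, so that \<open>G\<close> has class at most \<open>c\<close> iff \<open>lower_central G c\<close> is trivial.\<close>

fun lower_central :: "('a, 'm) monoid_scheme \<Rightarrow> nat \<Rightarrow> 'a set" where
  "lower_central G 0 = carrier G"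
| "lower_central G (Suc n) =
     generate G (\<Union>x\<in>lower_central G n. \<Union>y\<in>carrier G.
       {x \<otimes>\<^bsub>G\<^esub> y \<otimes>\<^bsub>G\<^esub> inv\<^bsub>G\<^esub> x \<otimes>\<^bsub>G\<^esub> inv\<^bsub>G\<^esub> y})"

definition nilpotent :: "('a, 'm) monoid_scheme \<Rightarrow> bool" where
  "nilpotent G \<longleftrightarrow> (\<exists>c. lower_central G c = {\<one>\<^bsub>G\<^esub>})"

definition nilpotency_class :: "('a, 'm) monoid_scheme \<Rightarrow> nat" where
  "nilpotency_class G = (LEAST c. lower_central G c = {\<one>\<^bsub>G\<^esub>})"

definition unique_roots :: "('a, 'm) monoid_scheme \<Rightarrow> bool" where
  "unique_roots G \<longleftrightarrow>
     (\<forall>x\<in>carrier G. \<forall>n::nat. n \<ge> 1 \<longrightarrow> (\<exists>!y. y \<in> carrier G \<and> y [^]\<^bsub>G\<^esub> n = x))"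

definition complete_tfn_group :: "('a, 'm) monoid_scheme \<Rightarrow> bool" where
  "complete_tfn_group G \<longleftrightarrow> group G \<and> torsion_free G \<and> nilpotent G \<and> unique_roots G"

text \<open>The inclusion of \<open>G\<close> into its completion \<open>R\<close> is an arbitrary embedding \<open>\<iota>\<close>, since the two groups
  may live in different types; literal containment is the case \<open>\<iota> = id\<close>.\<close>

definition maltsev_completion ::
    "('a, 'm) monoid_scheme \<Rightarrow> ('b, 'n) monoid_scheme \<Rightarrow> ('a \<Rightarrow> 'b) \<Rightarrow> bool" where
  "maltsev_completion G R \<iota> \<longleftrightarrow>
     complete_tfn_group R \<and> \<iota> \<in> hom G R \<and> inj_on \<iota> (carrier G) \<and>
     (\<forall>H. subgroup H R \<and> \<iota> ` carrier G \<subseteq> H \<and> complete_tfn_group (R\<lparr>carrier := H\<rparr>)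
        \<longrightarrow> H = carrier R)"

end

theory Submission
  imports Defs
begin

text \<open>The elements of \<open>R\<close> having a power in \<open>\<iota>(G)\<close> form a complete subgroup of class at most \<open>2\<close>, so by
  minimality they exhaust \<open>R\<close>. As \<open>R\<close> has class \<open>2\<close>, \<open>x + y = x y h(y, x)\<close> with \<open>h(y, x)\<^sup>2 = [y, x]\<close> is an
  abelian group law on \<open>R\<close>. On any finitely generated subgroup there is an additive projection \<open>p\<close>
  onto the center, and \<open>\<delta>(x) = x\<^bsup>n\<^esup> p(x)\<^bsup>n(n-1)\<^esup>\<close> is an injective homomorphism, which for suitable \<open>n\<close>
  maps the finitely many generators into \<open>\<iota>(G)\<close>. Hence every homomorphism from a free group \<open>W(X)\<close> to
  \<open>R\<close> has the same kernel as a homomorphism to \<open>G\<close>.\<close>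

section \<open>Groups with unique roots\<close>

text \<open>The convention of the generators in \<open>lower_central\<close>: swapping two factors
  puts the commutator on the left,
  \<open>x \<otimes> y = commutator G x y \<otimes> (y \<otimes> x)\<close>.\<close>

definition commutator :: "('a, 'm) monoid_scheme \<Rightarrow> 'a \<Rightarrow> 'a \<Rightarrow> 'a" where
  "commutator G x y = x \<otimes>\<^bsub>G\<^esub> y \<otimes>\<^bsub>G\<^esub> inv\<^bsub>G\<^esub> x \<otimes>\<^bsub>G\<^esub> inv\<^bsub>G\<^esub> y"

section \<open>Commutator calculus and powers of products\<close>

context group
begin

lemma commutator_closed [simp, intro]:
  "x \<in> carrier G \<Longrightarrow> y \<in> carrier G \<Longrightarrow> commutator G x y \<in> carrier G"
  by (simp add: commutator_def)

lemma mult_eq_commutator_mult: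
  "x \<in> carrier G \<Longrightarrow> y \<in> carrier G \<Longrightarrow> x \<otimes> y = commutator G x y \<otimes> (y \<otimes> x)"
  by (simp add: commutator_def m_assoc inv_solve_left flip: inv_mult_group)

lemma commutator_eqI:
  assumes "x \<in> carrier G" "y \<in> carrier G" "c \<in> carrier G" "x \<otimes> y = c \<otimes> (y \<otimes> x)"
  shows "commutator G x y = c"
proof -
  have "commutator G x y \<otimes> (y \<otimes> x) = c \<otimes> (y \<otimes> x)"
    using mult_eq_commutator_mult[OF assms(1,2)] assms(4) by simp
  then show ?thesis
    by (subst (asm) right_cancel) (use assms(1-3) in auto)
qed

lemma inv_commutator:
  "x \<in> carrier G \<Longrightarrow> y \<in> carrier G \<Longrightarrow> inv (commutator G x y) = commutator G y x"
  by (simp add: commutator_def inv_mult_group m_assoc)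

lemma commutator_eq_one_iff:
  assumes "x \<in> carrier G" "y \<in> carrier G"
  shows "commutator G x y = \<one> \<longleftrightarrow> x \<otimes> y = y \<otimes> x"
proof
  assume "commutator G x y = \<one>"
  then show "x \<otimes> y = y \<otimes> x" using mult_eq_commutator_mult[OF assms] assms by simp
next
  assume "x \<otimes> y = y \<otimes> x"
  then show "commutator G x y = \<one>" using assms by (intro commutator_eqI) simp_all
qed

lemma commutes_inv:
  assumes "x \<otimes> y = y \<otimes> x" "x \<in> carrier G" "y \<in> carrier G"
  shows "inv x \<otimes> y = y \<otimes> inv x"
proof -
  have "inv x \<otimes> y = inv x \<otimes> (y \<otimes> x) \<otimes> inv x"
    using assms(2,3) by (simp add: m_assoc)
  also have "\<dots> = inv x \<otimes> (x \<otimes> y) \<otimes> inv x"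
    by (simp only: assms(1))
  also have "\<dots> = y \<otimes> inv x"
    using assms(2,3) by (simp add: m_assoc[symmetric])
  finally show ?thesis .
qed

lemma commutes_mult:
  assumes "x \<otimes> z = z \<otimes> x" "y \<otimes> z = z \<otimes> y" "x \<in> carrier G" "y \<in> carrier G" "z \<in> carrier G"
  shows "(x \<otimes> y) \<otimes> z = z \<otimes> (x \<otimes> y)"
proof -
  have "(x \<otimes> y) \<otimes> z = x \<otimes> (z \<otimes> y)"
    using assms(2-5) by (simp add: m_assoc)
  also have "\<dots> = (z \<otimes> x) \<otimes> y"
    using assms(3-5) by (simp only: m_assoc[symmetric] assms(1))
  finally show ?thesis using assms(3-5) by (simp add: m_assoc)
qed

text \<open>The collection formula of class two groups. With \<open>h\<close> a square root of
  \<open>commutator G y x\<close>, the usual exponent \<open>k * (k - 1) div 2\<close> of the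
  commutator becomes \<open>k * (k - 1)\<close> and no division occurs. Only commutation of
  \<open>h\<close> with \<open>x\<close> and \<open>y\<close> enters, so the formula is available
  before the ambient group is known to have class two.\<close>

lemma pow_mult_commutator_root:
  fixes k :: nat
  assumes x: "x \<in> carrier G" and y: "y \<in> carrier G" and h: "h \<in> carrier G"
    and hx: "h \<otimes> x = x \<otimes> h" and hy: "h \<otimes> y = y \<otimes> h"
    and yx: "y \<otimes> x = h \<otimes> h \<otimes> (x \<otimes> y)"
  shows "(x \<otimes> y) [^] k = x [^] k \<otimes> y [^] k \<otimes> h [^] (k * (k - 1))"
proof (induction k)
  case (Suc k)
  have hxy: "h \<otimes> (x \<otimes> y) = x \<otimes> y \<otimes> h"
    using commutes_mult[OF hx[symmetric] hy[symmetric] x y h] by simp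
  have hhxy: "h \<otimes> h \<otimes> (x \<otimes> y) = x \<otimes> y \<otimes> (h \<otimes> h)"
    by (rule commutes_mult) (use hxy x y h in auto)
  have hhy: "y [^] j \<otimes> (h \<otimes> h) = h \<otimes> h \<otimes> y [^] j" for j :: nat
    by (rule group_commutes_pow) (use commutes_mult[OF hy hy h h y] y h in auto)
  \<comment> \<open>Moving \<open>x\<close> to the left past \<open>y [^] k\<close> costs one
    commutator \<open>h \<otimes> h\<close> for each factor \<open>y\<close>.\<close>
  have yk: "y [^] k \<otimes> x = x \<otimes> y [^] k \<otimes> h [^] (2 * k)"
  proof (induction k)
    case (Suc k)
    have "y [^] Suc k \<otimes> x = y \<otimes> (y [^] k \<otimes> x)"
      unfolding nat_pow_Suc2[OF y] using x y by (simp add: m_assoc)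
    also have "\<dots> = (y \<otimes> x) \<otimes> y [^] k \<otimes> h [^] (2 * k)"
      using Suc x y h by (simp add: m_assoc)
    also have "\<dots> = x \<otimes> y \<otimes> (h \<otimes> h) \<otimes> y [^] k \<otimes> h [^] (2 * k)"
      unfolding yx hhxy using x y h by (simp add: m_assoc)
    also have "\<dots> = x \<otimes> y \<otimes> (y [^] k \<otimes> (h \<otimes> h)) \<otimes> h [^] (2 * k)"
      unfolding hhy using x y h by (simp add: m_assoc)
    also have "\<dots> = x \<otimes> y [^] Suc k \<otimes> h [^] (2 * Suc k)"
    proof -
      have "h \<otimes> h \<otimes> h [^] (2 * k) = h [^] (2 * Suc k)" "y \<otimes> y [^] k = y [^] Suc k"
        using nat_pow_Suc2[OF h] nat_pow_Suc2[OF y] h by (simp_all add: m_assoc del: nat_pow_Suc)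
      moreover have "x \<otimes> y \<otimes> (y [^] k \<otimes> (h \<otimes> h)) \<otimes> h [^] (2 * k) =
          x \<otimes> (y \<otimes> y [^] k) \<otimes> (h \<otimes> h \<otimes> h [^] (2 * k))"
        using x y h by (simp add: m_assoc)
      ultimately show ?thesis by simp
    qed
    finally show ?case .
  qed (use x in simp)
  have com: "h [^] n \<otimes> (x \<otimes> y) = x \<otimes> y \<otimes> h [^] n" "h [^] n \<otimes> y = y \<otimes> h [^] n" for n :: nat
    using group_commutes_pow[of h] commutes_mult[of x h y] hx hy x y h by simp_all
  \<comment> \<open>Truncated subtraction makes \<open>k = 0\<close> a case of its own.\<close>
  have exp: "2 * k + k * (k - 1) = Suc k * (Suc k - 1)"
    by (cases k) (auto simp: algebra_simps)
  have "(x \<otimes> y) [^] Suc k = x [^] k \<otimes> y [^] k \<otimes> (h [^] (k * (k - 1)) \<otimes> (x \<otimes> y))"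
    using Suc x y h by (simp add: m_assoc)
  also have "\<dots> = x [^] k \<otimes> (y [^] k \<otimes> x) \<otimes> y \<otimes> h [^] (k * (k - 1))"
    using x y h by (simp add: com(1) m_assoc)
  also have "\<dots> = x [^] k \<otimes> x \<otimes> y [^] k \<otimes> (h [^] (2 * k) \<otimes> y) \<otimes> h [^] (k * (k - 1))"
    unfolding yk using x y h by (simp add: m_assoc)
  also have "\<dots> = x [^] Suc k \<otimes> y [^] Suc k \<otimes> (h [^] (2 * k) \<otimes> h [^] (k * (k - 1)))"
    unfolding com(2) using x y h by (simp add: m_assoc)
  also have "\<dots> = x [^] Suc k \<otimes> y [^] Suc k \<otimes> h [^] (Suc k * (Suc k - 1))"
    unfolding exp[symmetric] using h by (simp add: nat_pow_mult del: nat_pow_Suc)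
  finally show ?case .
qed simp

end

section \<open>Descending from commutation of powers to commutation of roots\<close>

locale unique_root_group = group +
  assumes unique_roots: "unique_roots G"
begin

lemma root_exists:
  "x \<in> carrier G \<Longrightarrow> n \<ge> 1 \<Longrightarrow> \<exists>y\<in>carrier G. y [^] (n::nat) = x"
  using unique_roots unfolding unique_roots_def by blast

lemma root_unique:
  "x \<in> carrier G \<Longrightarrow> y \<in> carrier G \<Longrightarrow> n \<ge> 1 \<Longrightarrow> x [^] (n::nat) = y [^] n \<Longrightarrow> x = y"
  using unique_roots unfolding unique_roots_def by (metis nat_pow_closed)

lemma pow_eq_one: "x \<in> carrier G \<Longrightarrow> n \<ge> 1 \<Longrightarrow> x [^] (n::nat) = \<one> \<Longrightarrow> x = \<one>"
  using root_unique[of x \<one> n] by simp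

lemma conj_pow:
  "x \<in> carrier G \<Longrightarrow> y \<in> carrier G \<Longrightarrow> (y \<otimes> x \<otimes> inv y) [^] (n::nat) = y \<otimes> x [^] n \<otimes> inv y"
proof (induction n)
  case (Suc n)
  then show ?case
    by (simp add: m_assoc inv_solve_left')
qed simp

text \<open>Conjugation by \<open>y\<close> permutes the roots of \<open>x [^] n\<close>, of which there is only one.\<close>

lemma commutes_root:
  assumes "x [^] n \<otimes> y = y \<otimes> x [^] n" "n \<ge> (1::nat)" "x \<in> carrier G" "y \<in> carrier G"
  shows "x \<otimes> y = y \<otimes> x"
proof -
  have "(y \<otimes> x \<otimes> inv y) [^] n = x [^] n"
    using assms by (simp add: conj_pow inv_solve_right')
  then have "y \<otimes> x \<otimes> inv y = x"
    using assms root_unique[of "y \<otimes> x \<otimes> inv y" x n] by simp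
  then show ?thesis
    using assms by (simp add: inv_solve_right')
qed

text \<open>The n-th root \<open>u\<close> of \<open>commutator G x (y [^] n)\<close> commutes with
  \<open>y\<close>, so \<open>u \<otimes> y\<close> and the conjugate of \<open>y\<close> by
  \<open>x\<close> have the same n-th power. Uniqueness of roots identifies them, and
  \<open>u\<close> is the commutator of \<open>x\<close> and \<open>y\<close>.\<close>

lemma commutator_pow_right:
  assumes x: "x \<in> carrier G" and y: "y \<in> carrier G" and n: "n \<ge> (1::nat)"
    and c: "commutator G x (y [^] n) \<otimes> y = y \<otimes> commutator G x (y [^] n)"
  shows "commutator G x y [^] n = commutator G x (y [^] n)"
proof -
  obtain u where u: "u \<in> carrier G" "u [^] n = commutator G x (y [^] n)"
    using root_exists[of "commutator G x (y [^] n)" n] x y n by auto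
  have uy: "u \<otimes> y = y \<otimes> u"
    using commutes_root[of u n y] u c n y by simp
  have "(u \<otimes> y) [^] n = commutator G x (y [^] n) \<otimes> y [^] n"
    using pow_mult_distrib[OF uy u(1) y] u by simp
  also have "\<dots> = (x \<otimes> y \<otimes> inv x) [^] n"
    unfolding conj_pow[OF y x] using x y by (simp add: commutator_def m_assoc)
  finally have "u \<otimes> y = x \<otimes> y \<otimes> inv x"
    using root_unique[of "u \<otimes> y" "x \<otimes> y \<otimes> inv x" n] u n x y by simp
  then have "commutator G x y = u"
    using x y u(1) by (simp add: commutator_def inv_solve_right')
  then show ?thesis using u by simp
qed

text \<open>Two applications of \<open>commutator_pow_right\<close>, one in each argument; the first
  argument is reached by inverting the commutator. This carries relations among powers down to the
  elements themselves.\<close>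

lemma commutator_pow_pow:
  fixes m n :: nat
  assumes x: "x \<in> carrier G" and y: "y \<in> carrier G" and mn: "m \<ge> 1" "n \<ge> 1"
    and cx: "commutator G (x [^] m) (y [^] n) \<otimes> x [^] m = x [^] m \<otimes> commutator G (x [^] m) (y [^] n)"
    and cy: "commutator G (x [^] m) (y [^] n) \<otimes> y [^] n = y [^] n \<otimes> commutator G (x [^] m) (y [^] n)"
  shows "commutator G x y [^] (m * n) = commutator G (x [^] m) (y [^] n)"
proof -
  let ?z = "commutator G (x [^] m) (y [^] n)"
  have zx: "?z \<otimes> x = x \<otimes> ?z" and zy: "?z \<otimes> y = y \<otimes> ?z"
    using commutes_root[of x m ?z] commutes_root[of y n ?z] assms by simp_all
  have 1: "commutator G (x [^] m) y [^] n = ?z"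
    by (intro commutator_pow_right) (use x y mn zy in auto)
  \<comment> \<open>This commutator is an n-th root of \<open>?z\<close>, so it inherits commutation
    with \<open>x\<close>.\<close>
  have "commutator G (x [^] m) y \<otimes> x = x \<otimes> commutator G (x [^] m) y"
    using commutes_root[of "commutator G (x [^] m) y" n x] 1 zx x y mn by simp
  then have "inv (commutator G (x [^] m) y) \<otimes> x = x \<otimes> inv (commutator G (x [^] m) y)"
    using commutes_inv x y by simp
  then have "commutator G y x [^] m = commutator G y (x [^] m)"
    by (intro commutator_pow_right) (use x y mn inv_commutator in auto)
  then have "commutator G x y [^] m = commutator G (x [^] m) y"
    using x y inv_commutator
    by (metis commutator_closed inv_inv nat_pow_closed nat_pow_inv)
  then show ?thesis
    using 1 x y by (simp add: nat_pow_pow[symmetric])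
qed

end


section \<open>Extending homomorphisms into divisible torsion free abelian groups\<close>

text \<open>Injectivity of divisible abelian groups, one generator at a time: \<open>x\<close> is
  sent to an element \<open>q\<close> that agrees with \<open>p\<close> on every power of
  \<open>x\<close> lying in \<open>D\<close>.\<close>

lemma hom_extend_one:
  fixes A :: "('a, 'm) monoid_scheme" and B :: "('b, 'n) monoid_scheme"
  assumes A: "comm_group A" and B: "comm_group B" and ur: "unique_root_group B"
    and D: "subgroup D A" and p: "p \<in> hom (A\<lparr>carrier := D\<rparr>) B" and x: "x \<in> carrier A"
  shows "\<exists>D' p'. subgroup D' A \<and> D \<subseteq> D' \<and> x \<in> D' \<and> p' \<in> hom (A\<lparr>carrier := D'\<rparr>) B \<and>
    (\<forall>d\<in>D. p' d = p d)"
proof -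
  interpret A: comm_group A by (rule A)
  interpret B: comm_group B by (rule B)
  interpret UB: unique_root_group B by (rule ur)
  interpret D: subgroup D A by (rule D)
  interpret AD: group "A\<lparr>carrier := D\<rparr>"
    using A.subgroup_imp_group[OF D] .
  interpret p: group_hom "A\<lparr>carrier := D\<rparr>" B p
    using p by unfold_locales (auto simp: hom_def)
  have DA: "d \<in> carrier A" if "d \<in> D" for d using that by simp
  have pc: "p d \<in> carrier B" if "d \<in> D" for d using p.hom_closed[of d] that by simp
  have pm: "p (d \<otimes>\<^bsub>A\<^esub> e) = p d \<otimes>\<^bsub>B\<^esub> p e" if "d \<in> D" "e \<in> D" for d e
    using p.hom_mult[of d e] that by simp
  have pp: "p (d [^]\<^bsub>A\<^esub> (n::nat)) = p d [^]\<^bsub>B\<^esub> n" "d [^]\<^bsub>A\<^esub> n \<in> D" if "d \<in> D" for d n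
    using p.hom_nat_pow[of d n] AD.nat_pow_closed[of d n] that
    by (simp_all flip: A.nat_pow_consistent)
  have ip: "p (d [^]\<^bsub>A\<^esub> (n::int)) = p d [^]\<^bsub>B\<^esub> n" if "d \<in> D" for d n
    using p.hom_int_pow[of d n] that A.int_pow_consistent[OF D, of d n] by simp
  have "\<exists>q\<in>carrier B. \<forall>j::int. x [^]\<^bsub>A\<^esub> j \<in> D \<longrightarrow> p (x [^]\<^bsub>A\<^esub> j) = q [^]\<^bsub>B\<^esub> j"
  proof (cases "\<exists>m::nat. m \<ge> 1 \<and> x [^]\<^bsub>A\<^esub> m \<in> D")
    case True
    then obtain m :: nat where m: "m \<ge> 1" "x [^]\<^bsub>A\<^esub> m \<in> D" by blast
    \<comment> \<open>If some positive power of \<open>x\<close> lies in \<open>D\<close>, then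
      \<open>q\<close> has to be a root of its image.\<close>
    obtain q where q: "q \<in> carrier B" "q [^]\<^bsub>B\<^esub> m = p (x [^]\<^bsub>A\<^esub> m)"
      using UB.root_exists[OF pc[OF m(2)] m(1)] by blast
    \<comment> \<open>For any other power of \<open>x\<close> in \<open>D\<close> it is enough to
      compare m-th powers: both sides become the power of \<open>q\<close> with exponent
      \<open>j * m\<close>.\<close>
    have "p (x [^]\<^bsub>A\<^esub> j) = q [^]\<^bsub>B\<^esub> j" if j: "x [^]\<^bsub>A\<^esub> j \<in> D" for j :: int
    proof (rule UB.root_unique[OF _ _ m(1)])
      have "p (x [^]\<^bsub>A\<^esub> j) [^]\<^bsub>B\<^esub> m = p ((x [^]\<^bsub>A\<^esub> j) [^]\<^bsub>A\<^esub> int m)"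
        using pp(1)[OF j] by (simp add: int_pow_int)
      also have "(x [^]\<^bsub>A\<^esub> j) [^]\<^bsub>A\<^esub> int m = (x [^]\<^bsub>A\<^esub> int m) [^]\<^bsub>A\<^esub> j"
        using x by (simp add: A.int_pow_pow mult.commute)
      also have "p \<dots> = (q [^]\<^bsub>B\<^esub> int m) [^]\<^bsub>B\<^esub> j"
        using ip[of "x [^]\<^bsub>A\<^esub> m" j] m(2) q by (simp add: int_pow_int)
      also have "\<dots> = (q [^]\<^bsub>B\<^esub> j) [^]\<^bsub>B\<^esub> int m"
        using q by (simp add: B.int_pow_pow mult.commute)
      finally show "p (x [^]\<^bsub>A\<^esub> j) [^]\<^bsub>B\<^esub> m = (q [^]\<^bsub>B\<^esub> j) [^]\<^bsub>B\<^esub> m"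
        by (simp add: int_pow_int)
    qed (use j pc q in auto)
    then show ?thesis using q by blast
  next
    \<comment> \<open>Here only the trivial power of \<open>x\<close> lies in \<open>D\<close>, so
      \<open>q\<close> can be chosen freely; the identity is taken.\<close>
    case False
    have "j = 0" if j: "x [^]\<^bsub>A\<^esub> j \<in> D" for j :: int
    proof (rule ccontr)
      assume "j \<noteq> 0"
      have "x [^]\<^bsub>A\<^esub> nat \<bar>j\<bar> \<in> D"
        using j D.m_inv_closed[OF j] x
        by (cases "j \<ge> 0") (auto simp: pow_nat abs_if A.int_pow_neg)
      then show False using False \<open>j \<noteq> 0\<close> by (metis One_nat_def Suc_leI abs_le_zero_iff nat_0_iff not_gr_zero)
    qed
    then have "p (x [^]\<^bsub>A\<^esub> j) = \<one>\<^bsub>B\<^esub> [^]\<^bsub>B\<^esub> j" if "x [^]\<^bsub>A\<^esub> j \<in> D" for j :: int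
      using that p.hom_one by fastforce
    then show ?thesis
      by (intro bexI[of _ "\<one>\<^bsub>B\<^esub>"]) auto
  qed
  then obtain q where q: "q \<in> carrier B"
    "\<And>j::int. x [^]\<^bsub>A\<^esub> j \<in> D \<Longrightarrow> p (x [^]\<^bsub>A\<^esub> j) = q [^]\<^bsub>B\<^esub> j" by blast
  define D' where "D' = {d \<otimes>\<^bsub>A\<^esub> x [^]\<^bsub>A\<^esub> (j::int) | d j. d \<in> D}"
  \<comment> \<open>The value at \<open>d\<close> times the j-th power of \<open>x\<close> is
    \<open>p d\<close> times the j-th power of \<open>q\<close>. The choice is harmless: two
    representations differ by a power of \<open>x\<close> lying in \<open>D\<close>, where
    \<open>q\<close> and \<open>p\<close> agree.\<close>
  define p' where "p' y = (SOME b. \<exists>d\<in>D. \<exists>j::int. y = d \<otimes>\<^bsub>A\<^esub> x [^]\<^bsub>A\<^esub> j \<and> b = p d \<otimes>\<^bsub>B\<^esub> q [^]\<^bsub>B\<^esub> j)" for y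
  have p': "p' (d \<otimes>\<^bsub>A\<^esub> x [^]\<^bsub>A\<^esub> j) = p d \<otimes>\<^bsub>B\<^esub> q [^]\<^bsub>B\<^esub> j" if d: "d \<in> D" for d and j :: int
    unfolding p'_def
  proof (rule some_equality)
    fix b assume "\<exists>e\<in>D. \<exists>k::int. d \<otimes>\<^bsub>A\<^esub> x [^]\<^bsub>A\<^esub> j = e \<otimes>\<^bsub>A\<^esub> x [^]\<^bsub>A\<^esub> k \<and> b = p e \<otimes>\<^bsub>B\<^esub> q [^]\<^bsub>B\<^esub> k"
    then obtain e k where e: "e \<in> D" "d \<otimes>\<^bsub>A\<^esub> x [^]\<^bsub>A\<^esub> j = e \<otimes>\<^bsub>A\<^esub> x [^]\<^bsub>A\<^esub> (k::int)"
      and b: "b = p e \<otimes>\<^bsub>B\<^esub> q [^]\<^bsub>B\<^esub> k" by blast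
    have "inv\<^bsub>A\<^esub> d \<otimes>\<^bsub>A\<^esub> e \<otimes>\<^bsub>A\<^esub> x [^]\<^bsub>A\<^esub> k = x [^]\<^bsub>A\<^esub> j"
      using e d x by (simp add: A.m_assoc A.inv_solve_left')
    then have de: "x [^]\<^bsub>A\<^esub> (j - k) = inv\<^bsub>A\<^esub> d \<otimes>\<^bsub>A\<^esub> e"
      using e(1) d x by (simp add: A.int_pow_diff A.inv_solve_right')
    moreover have deD: "inv\<^bsub>A\<^esub> d \<otimes>\<^bsub>A\<^esub> e \<in> D" using d e by simp
    ultimately have "p (inv\<^bsub>A\<^esub> d \<otimes>\<^bsub>A\<^esub> e) = q [^]\<^bsub>B\<^esub> (j - k)" using q(2)[of "j - k"] by simp
    moreover have "e = d \<otimes>\<^bsub>A\<^esub> (inv\<^bsub>A\<^esub> d \<otimes>\<^bsub>A\<^esub> e)"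
      using d e(1) by (simp add: A.m_assoc[symmetric])
    ultimately have "p e = p d \<otimes>\<^bsub>B\<^esub> q [^]\<^bsub>B\<^esub> (j - k)" using pm[OF d deD] by simp
    then show "b = p d \<otimes>\<^bsub>B\<^esub> q [^]\<^bsub>B\<^esub> j"
      unfolding b using q(1) pc[OF d] by (simp add: B.m_assoc B.int_pow_mult[symmetric])
  qed (use d in blast)
  have mult: "(d \<otimes>\<^bsub>A\<^esub> x [^]\<^bsub>A\<^esub> j) \<otimes>\<^bsub>A\<^esub> (e \<otimes>\<^bsub>A\<^esub> x [^]\<^bsub>A\<^esub> k) = d \<otimes>\<^bsub>A\<^esub> e \<otimes>\<^bsub>A\<^esub> x [^]\<^bsub>A\<^esub> (j + k)"
    if "d \<in> D" "e \<in> D" for d e and j k :: int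
    using that x by (simp add: A.int_pow_mult A.m_ac)
  have "subgroup D' A"
  proof (rule A.subgroupI)
    show "D' \<subseteq> carrier A" using x by (auto simp: D'_def)
    show "D' \<noteq> {}" unfolding D'_def using D.one_closed by fast
  next
    fix a assume "a \<in> D'"
    then obtain d and j :: int where "d \<in> D" "a = d \<otimes>\<^bsub>A\<^esub> x [^]\<^bsub>A\<^esub> j" by (auto simp: D'_def)
    then have "inv\<^bsub>A\<^esub> a = inv\<^bsub>A\<^esub> d \<otimes>\<^bsub>A\<^esub> x [^]\<^bsub>A\<^esub> (- j)" "inv\<^bsub>A\<^esub> d \<in> D"
      using x by (simp_all add: A.inv_mult A.int_pow_neg)
    then show "inv\<^bsub>A\<^esub> a \<in> D'" by (auto simp: D'_def)
  next
    fix a b assume "a \<in> D'" "b \<in> D'"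
    then show "a \<otimes>\<^bsub>A\<^esub> b \<in> D'" unfolding D'_def using mult D.m_closed by fast
  qed
  moreover have D': "d \<in> D'" "p' d = p d" if "d \<in> D" for d
  proof -
    have "d = d \<otimes>\<^bsub>A\<^esub> x [^]\<^bsub>A\<^esub> (0::int)" using that by simp
    then show "d \<in> D'" unfolding D'_def using that by blast
    show "p' d = p d" using p'[OF that, of 0] that pc[OF that] by simp
  qed
  moreover have "x \<in> D'"
  proof -
    have "x = \<one>\<^bsub>A\<^esub> \<otimes>\<^bsub>A\<^esub> x [^]\<^bsub>A\<^esub> (1::int)" using x by simp
    then show ?thesis unfolding D'_def using D.one_closed by blast
  qed
  moreover have "p' \<in> hom (A\<lparr>carrier := D'\<rparr>) B"
  proof (rule homI)
    fix a assume "a \<in> carrier (A\<lparr>carrier := D'\<rparr>)"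
    then show "p' a \<in> carrier B" using p' pc q(1) by (auto simp: D'_def)
  next
    fix a b assume "a \<in> carrier (A\<lparr>carrier := D'\<rparr>)" "b \<in> carrier (A\<lparr>carrier := D'\<rparr>)"
    then obtain d e and j k :: int where
      "d \<in> D" "e \<in> D" "a = d \<otimes>\<^bsub>A\<^esub> x [^]\<^bsub>A\<^esub> j" "b = e \<otimes>\<^bsub>A\<^esub> x [^]\<^bsub>A\<^esub> k" by (auto simp: D'_def)
    then show "p' (a \<otimes>\<^bsub>A\<lparr>carrier := D'\<rparr>\<^esub> b) = p' a \<otimes>\<^bsub>B\<^esub> p' b"
      using q(1) by (simp add: mult p' pm pc B.int_pow_mult B.m_ac)
  qed
  ultimately show ?thesis by blast
qed

text \<open>Only finitely many elements have to be reached, so induction over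
  \<open>hom_extend_one\<close> takes the place of a maximality argument.\<close>

lemma hom_extend_finite:
  fixes A :: "('a, 'm) monoid_scheme" and B :: "('b, 'n) monoid_scheme"
  assumes A: "comm_group A" and B: "comm_group B" "unique_root_group B"
    and D: "subgroup D A" "p \<in> hom (A\<lparr>carrier := D\<rparr>) B"
    and S: "finite S" "S \<subseteq> carrier A"
  shows "\<exists>D' p'. subgroup D' A \<and> D \<union> S \<subseteq> D' \<and> p' \<in> hom (A\<lparr>carrier := D'\<rparr>) B \<and>
    (\<forall>d\<in>D. p' d = p d)"
  using S
proof (induction S)
  case empty
  then show ?case using D by auto
next
  case (insert x S)
  then obtain D1 p1 where 1: "subgroup D1 A" "D \<union> S \<subseteq> D1" "p1 \<in> hom (A\<lparr>carrier := D1\<rparr>) B"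
    "\<forall>d\<in>D. p1 d = p d" by auto
  obtain D2 p2 where "subgroup D2 A" "D1 \<subseteq> D2" "x \<in> D2" "p2 \<in> hom (A\<lparr>carrier := D2\<rparr>) B"
    "\<forall>d\<in>D1. p2 d = p1 d"
    using hom_extend_one[OF A B 1(1,3), of x] insert.prems by auto
  with 1 show ?case by (intro exI[of _ D2] exI[of _ p2]) auto
qed


section \<open>Free groups of a variety\<close>

abbreviation reduced :: "'x word \<Rightarrow> bool" where
  "reduced \<equiv> successively (\<lambda>l m. m \<noteq> inv_letter l)"

lemma inv_letter_inv_letter [simp]: "inv_letter (inv_letter l) = l"
  by (cases l) (simp add: inv_letter_def)

lemma reduced_cons_reduce: "reduced w \<Longrightarrow> reduced (cons_reduce l w)"
  by (cases w) (auto simp: successively_Cons)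

lemma cons_reduce_inv_letter: "reduced w \<Longrightarrow> cons_reduce l (cons_reduce (inv_letter l) w) = w"
  \<comment> \<open>The rule serves to split words by length 0, 1 and at least 2: once the first
    letter has cancelled, the second one decides, and reducedness keeps it from cancelling
    too.\<close>
  by (cases w rule: remdups_adj.cases) auto

lemma set_cons_reduce: "set (cons_reduce l w) \<subseteq> insert l (set w)"
  by (cases w) auto

lemma reduced_foldr: "reduced w \<Longrightarrow> reduced (foldr cons_reduce u w)"
  by (induction u) (auto simp: reduced_cons_reduce)

lemma set_foldr_cons_reduce: "set (foldr cons_reduce u w) \<subseteq> set u \<union> set w"
  using set_cons_reduce by (induction u) fastforce+

text \<open>Van der Waerden's argument: letters act on reduced words, a letter and its inverse
  acting by inverse maps. Cancelling a pair of letters in the acting word therefore does not change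
  its action.\<close>

lemma foldr_cons_reduce_assoc:
  "reduced w \<Longrightarrow> foldr cons_reduce (foldr cons_reduce u v) w = foldr cons_reduce u (foldr cons_reduce v w)"
proof (induction u)
  case (Cons l u)
  have "foldr cons_reduce (cons_reduce l v) w = cons_reduce l (foldr cons_reduce v w)" for v
    using Cons.prems cons_reduce_inv_letter[OF reduced_foldr[OF Cons.prems]] by (cases v) auto
  then show ?case using Cons by simp
qed simp

lemma foldr_cons_reduce_Nil: "reduced u \<Longrightarrow> foldr cons_reduce u [] = u"
proof (induction u)
  case (Cons l u)
  then show ?case by (cases u) auto
qed simp

lemma foldr_cons_reduce_inverse:
  "reduced w \<Longrightarrow> foldr cons_reduce (rev (map inv_letter u)) (foldr cons_reduce u w) = w"
proof (induction u arbitrary: w)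
  case (Cons l u)
  then show ?case
    using cons_reduce_inv_letter[of "foldr cons_reduce u w" "inv_letter l"]
    by (simp add: reduced_foldr)
qed simp

lemma reduced_rev_map_inv_letter: "reduced u \<Longrightarrow> reduced (rev (map inv_letter u))"
  by (auto simp: successively_map successively_rev elim!: successively_mono)

lemma group_free_group: "group (free_group X)"
proof (rule groupI)
  fix u v assume "u \<in> carrier (free_group X)" "v \<in> carrier (free_group X)"
  then show "u \<otimes>\<^bsub>free_group X\<^esub> v \<in> carrier (free_group X)"
    using set_foldr_cons_reduce[of u v] reduced_foldr[of v u]
    by (auto simp: free_group_def in_lists_conv_set)
next
  fix u assume u: "u \<in> carrier (free_group X)"
  show "\<exists>v\<in>carrier (free_group X). v \<otimes>\<^bsub>free_group X\<^esub> u = \<one>\<^bsub>free_group X\<^esub>"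
  proof
    show "rev (map inv_letter u) \<in> carrier (free_group X)"
      using u reduced_rev_map_inv_letter[of u]
      by (auto simp: free_group_def in_lists_conv_set inv_letter_def)
    show "rev (map inv_letter u) \<otimes>\<^bsub>free_group X\<^esub> u = \<one>\<^bsub>free_group X\<^esub>"
      using u foldr_cons_reduce_inverse[of "[]" u]
      by (simp add: free_group_def foldr_cons_reduce_Nil)
  qed
qed (auto simp: free_group_def foldr_cons_reduce_assoc)

section \<open>Verbal subgroups and their quotients\<close>

lemma (in group) word_val_closed: "f \<in> UNIV \<rightarrow> carrier G \<Longrightarrow> word_val G f w \<in> carrier G"
proof (induction w)
  case (Cons l w)
  then show ?case by (cases l) (auto simp: Pi_iff)
qed simp

lemma (in group) word_val_conj:
  assumes f: "f \<in> UNIV \<rightarrow> carrier G" and g: "g \<in> carrier G"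
  shows "word_val G (\<lambda>x. g \<otimes> f x \<otimes> inv g) w = g \<otimes> word_val G f w \<otimes> inv g"
proof (induction w)
  case (Cons l w)
  have "f x \<in> carrier G" for x using f by auto
  with Cons g word_val_closed[OF f, of w] show ?case
    by (cases l) (simp add: m_assoc inv_mult_group inv_solve_left')
qed (use g in simp)

text \<open>A conjugate of a word value is the value at the conjugated assignment, so the generating
  set is already closed under conjugation.\<close>

lemma (in group) normal_verbal_subgroup: "verbal_subgroup \<Theta> G \<lhd> G"
  unfolding verbal_subgroup_def
proof (rule normal_generateI)
  show "{word_val G f w |f w. w \<in> \<Theta> \<and> f \<in> UNIV \<rightarrow> carrier G} \<subseteq> carrier G"
    using word_val_closed by auto
next
  fix h g assume "h \<in> {word_val G f w |f w. w \<in> \<Theta> \<and> f \<in> UNIV \<rightarrow> carrier G}" and g: "g \<in> carrier G"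
  then obtain f w where fw: "h = word_val G f w" "w \<in> \<Theta>" "f \<in> UNIV \<rightarrow> carrier G" by blast
  then have "g \<otimes> h \<otimes> inv g = word_val G (\<lambda>x. g \<otimes> f x \<otimes> inv g) w"
    using word_val_conj[OF fw(3) g] by simp
  moreover have "(\<lambda>x. g \<otimes> f x \<otimes> inv g) \<in> UNIV \<rightarrow> carrier G" using fw(3) g by auto
  ultimately show "g \<otimes> h \<otimes> inv g \<in> {word_val G f w |f w. w \<in> \<Theta> \<and> f \<in> UNIV \<rightarrow> carrier G}"
    using fw(2) by blast
qed

text \<open>The closure condition on \<open>E\<close> can omit inverses, as \<open>X\<close> and its inverses generate \<open>W(X)\<close> as a monoid.\<close>

lemma variety_free_group_hom_image:
  fixes X :: "'x set"
  assumes X: "finite X" and H: "group H"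
    and \<nu>: "\<nu> \<in> hom (variety_free_group \<Theta> X) H"
  obtains S where "finite S" "S \<subseteq> carrier H"
    "\<And>E. \<lbrakk>\<one>\<^bsub>H\<^esub> \<in> E; S \<subseteq> E; \<forall>a\<in>E. \<forall>b\<in>E. a \<otimes>\<^bsub>H\<^esub> b \<in> E\<rbrakk>
      \<Longrightarrow> \<nu> ` carrier (variety_free_group \<Theta> X) \<subseteq> E"
proof -
  let ?F = "free_group X" and ?N = "verbal_subgroup \<Theta> (free_group X)"
  interpret F: group ?F by (rule group_free_group)
  interpret N: normal ?N ?F by (rule F.normal_verbal_subgroup)
  interpret H: group H by (rule H)
  \<comment> \<open>Pulling \<open>\<nu>\<close> back along the quotient map allows induction on
    reduced words.\<close>
  define f where "f = \<nu> \<circ> (\<lambda>w. ?N #>\<^bsub>?F\<^esub> w)"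
  have f: "f \<in> hom ?F H"
    unfolding f_def by (rule hom_compose[OF N.r_coset_hom_Mod]) (use \<nu> in \<open>simp add: variety_free_group_def\<close>)
  interpret f: group_hom ?F H f
    using f by unfold_locales
  let ?S = "(\<lambda>l. f [l]) ` (UNIV \<times> X)"
  have l: "[l] \<in> carrier ?F" if "l \<in> UNIV \<times> X" for l
    using that by (auto simp: free_group_def)
  show thesis
  proof (rule that)
    show "finite ?S" using X by simp
    show "?S \<subseteq> carrier H" using l f.hom_closed by blast
    fix E assume E: "\<one>\<^bsub>H\<^esub> \<in> E" "?S \<subseteq> E" "\<forall>a\<in>E. \<forall>b\<in>E. a \<otimes>\<^bsub>H\<^esub> b \<in> E"
    have fE: "f w \<in> E" if "w \<in> carrier ?F" for w
      using that
    proof (induction w)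
      case Nil
      then show ?case using f.hom_one E(1) by (simp add: free_group_def)
    next
      case (Cons l w)
      then have w: "w \<in> carrier ?F" "l \<in> UNIV \<times> X" "reduced (l # w)"
        by (auto simp: free_group_def successively_Cons)
      \<comment> \<open>No cancellation takes place here, because \<open>l # w\<close> is
        reduced.\<close>
      then have "l # w = [l] \<otimes>\<^bsub>?F\<^esub> w"
        by (cases w) (auto simp: free_group_def)
      then have "f (l # w) = f [l] \<otimes>\<^bsub>H\<^esub> f w"
        using f.hom_mult[OF l[OF w(2)] w(1)] by simp
      then show ?case using Cons.IH[OF w(1)] w(2) E by auto
    qed
    have "carrier (variety_free_group \<Theta> X) = (\<lambda>w. ?N #>\<^bsub>?F\<^esub> w) ` carrier ?F"
      by (auto simp: variety_free_group_def FactGroup_def RCOSETS_def)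
    then show "\<nu> ` carrier (variety_free_group \<Theta> X) \<subseteq> E"
      using fE by (auto simp: f_def)
  qed
qed


section \<open>Mal'tsev completions in class two\<close>

definition center :: "('a, 'm) monoid_scheme \<Rightarrow> 'a set" where
  "center G = {z \<in> carrier G. \<forall>x\<in>carrier G. z \<otimes>\<^bsub>G\<^esub> x = x \<otimes>\<^bsub>G\<^esub> z}"

text \<open>Class at most two, stated without reference to the lower central series.\<close>

definition central_commutators :: "('a, 'm) monoid_scheme \<Rightarrow> bool" where
  "central_commutators G \<longleftrightarrow> (\<forall>x\<in>carrier G. \<forall>y\<in>carrier G. commutator G x y \<in> center G)"

context group
begin

lemma center_closed: "z \<in> center G \<Longrightarrow> z \<in> carrier G"
  and center_commutes: "z \<in> center G \<Longrightarrow> x \<in> carrier G \<Longrightarrow> z \<otimes> x = x \<otimes> z"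
  unfolding center_def by blast+

lemma subgroup_center: "subgroup (center G) G"
proof (rule subgroupI)
  have "\<one> \<in> center G" by (simp add: center_def)
  then show "center G \<noteq> {}" by blast
next
  fix z assume "z \<in> center G"
  then show "inv z \<in> center G"
    unfolding center_def using commutes_inv by blast
next
  fix z w assume "z \<in> center G" "w \<in> center G"
  then show "z \<otimes> w \<in> center G"
    unfolding center_def using commutes_mult by blast
qed (use center_closed in blast)

text \<open>Both sides say that the commutator subgroup, which is \<open>lower_central G 1\<close>
  in the indexing from 0, lies in the center.\<close>

lemma lower_central_2_iff:
  "lower_central G 2 = {\<one>} \<longleftrightarrow> central_commutators G"
proof
  assume l: "lower_central G 2 = {\<one>}"
  have "commutator G x y \<otimes> z = z \<otimes> commutator G x y"
    if xyz: "x \<in> carrier G" "y \<in> carrier G" "z \<in> carrier G" for x y z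
  proof -
    have "commutator G x y \<in> lower_central G (Suc 0)"
      using xyz by (auto simp: commutator_def intro!: generate.incl)
    then have "commutator G (commutator G x y) z \<in> lower_central G (Suc (Suc 0))"
      using xyz unfolding lower_central.simps(2)[of _ "Suc 0"]
      by (intro generate.incl) (auto simp: commutator_def[of _ "commutator G x y"])
    then show ?thesis
      using l xyz commutator_eq_one_iff by (simp add: numeral_2_eq_2 del: lower_central.simps)
  qed
  then show "central_commutators G"
    by (simp add: central_commutators_def center_def)
next
  assume c: "central_commutators G"
  have 1: "lower_central G (Suc 0) \<subseteq> center G"
    unfolding lower_central.simps
    by (rule generate_subgroup_incl[OF _ subgroup_center])
      (use c in \<open>auto simp: central_commutators_def commutator_def\<close>)
  have "lower_central G (Suc (Suc 0)) \<subseteq> {\<one>}"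
    unfolding lower_central.simps(2)[of _ "Suc 0"]
  proof (rule generate_subgroup_incl[OF _ triv_subgroup])
    have "commutator G x y = \<one>" if "x \<in> center G" "y \<in> carrier G" for x y
      using that commutator_eq_one_iff center_commutes center_closed by blast
    then show "(\<Union>x\<in>lower_central G (Suc 0). \<Union>y\<in>carrier G. {x \<otimes> y \<otimes> inv x \<otimes> inv y}) \<subseteq> {\<one>}"
      using 1 by (auto simp: commutator_def)
  qed
  moreover have "\<one> \<in> lower_central G (Suc (Suc 0))"
    by (simp add: generate.one)
  ultimately show "lower_central G 2 = {\<one>}"
    by (auto simp: numeral_2_eq_2 simp del: lower_central.simps)
qed

end

section \<open>Isolators of subgroups of class two\<close>

context unique_root_group
begin

lemma unique_root_subgroup:
  assumes H: "subgroup H G" and r: "\<And>x n. x \<in> carrier G \<Longrightarrow> n \<ge> (1::nat) \<Longrightarrow> x [^] n \<in> H \<Longrightarrow> x \<in> H"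
  shows "unique_root_group (G\<lparr>carrier := H\<rparr>)"
proof -
  interpret H: subgroup H G by (rule H)
  have "\<exists>!y. y \<in> H \<and> y [^] n = x" if x: "x \<in> H" and n: "n \<ge> (1::nat)" for x n
  proof -
    obtain y where "y \<in> carrier G" "y [^] n = x" using root_exists[of x n] x n by auto
    then show ?thesis using r[of y n] root_unique n x by (metis H.mem_carrier)
  qed
  then have "unique_roots (G\<lparr>carrier := H\<rparr>)"
    unfolding unique_roots_def by (simp flip: nat_pow_consistent)
  then show ?thesis
    using subgroup_imp_group[OF H] by (simp add: unique_root_group_def unique_root_group_axioms_def)
qed

text \<open>By \<open>commutator_pow_pow\<close>, \<open>commutator G x y [^] (m * n)\<close> is a
  commutator of elements of \<open>K\<close>. Commutation with \<open>w\<close> then comes from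
  \<open>commutes_root\<close> used twice: once to pass from \<open>w [^] l\<close> to
  \<open>w\<close>, once to pass from this power to \<open>commutator G x y\<close>.\<close>

lemma isolator_central:
  assumes K: "subgroup K G" and c: "\<And>x y z. x \<in> K \<Longrightarrow> y \<in> K \<Longrightarrow> z \<in> K \<Longrightarrow>
      commutator G x y \<otimes> z = z \<otimes> commutator G x y"
    and x: "x \<in> carrier G" "m \<ge> (1::nat)" "x [^] m \<in> K"
    and y: "y \<in> carrier G" "n \<ge> (1::nat)" "y [^] n \<in> K"
  shows "commutator G x y [^] (m * n) \<in> K"
    and "\<lbrakk>w \<in> carrier G; l \<ge> (1::nat); w [^] l \<in> K\<rbrakk> \<Longrightarrow> commutator G x y \<otimes> w = w \<otimes> commutator G x y"
proof -
  interpret K: subgroup K G by (rule K)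
  have eq: "commutator G x y [^] (m * n) = commutator G (x [^] m) (y [^] n)"
    by (rule commutator_pow_pow) (use x y c in auto)
  then show "commutator G x y [^] (m * n) \<in> K"
    using x y by (simp add: commutator_def)
  assume w: "w \<in> carrier G" "l \<ge> (1::nat)" "w [^] l \<in> K"
  have "w \<otimes> commutator G (x [^] m) (y [^] n) = commutator G (x [^] m) (y [^] n) \<otimes> w"
    by (rule commutes_root[of w l]) (use w x y c in auto)
  then show "commutator G x y \<otimes> w = w \<otimes> commutator G x y"
    using commutes_root[of "commutator G x y" "m * n" w] eq x y w by simp
qed

text \<open>The delicate point is closure of \<open>H\<close> under products, which is read off from
  the collection formula; \<open>isolator_central\<close> gives the centrality of
  commutators.\<close>

lemma isolator_class_two:
  assumes K: "subgroup K G" and c: "\<And>x y z. x \<in> K \<Longrightarrow> y \<in> K \<Longrightarrow> z \<in> K \<Longrightarrow>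
      commutator G x y \<otimes> z = z \<otimes> commutator G x y"
  defines "H \<equiv> {x \<in> carrier G. \<exists>m::nat. m \<ge> 1 \<and> x [^] m \<in> K}"
  shows "subgroup H G" and "central_commutators (G\<lparr>carrier := H\<rparr>)"
    and "unique_root_group (G\<lparr>carrier := H\<rparr>)"
proof -
  interpret K: subgroup K G by (rule K)
  have Kpow: "x [^] (m * n) \<in> K" if "x [^] m \<in> K" "x \<in> carrier G" for x and m n :: nat
  proof -
    have "(x [^] m) [^] n \<in> K"
      using that(1) by (induction n) auto
    then show ?thesis using that by (simp add: nat_pow_pow)
  qed
  show H: "subgroup H G"
  proof (rule subgroupI)
    show "H \<subseteq> carrier G" by (auto simp: H_def)
    have "\<one> \<in> H" unfolding H_def using K.one_closed by (auto intro!: exI[of _ 1])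
    then show "H \<noteq> {}" by blast
  next
    fix x assume "x \<in> H"
    then obtain m :: nat where "x \<in> carrier G" "m \<ge> 1" "x [^] m \<in> K" unfolding H_def by blast
    then show "inv x \<in> H" unfolding H_def by (auto simp: nat_pow_inv intro!: exI[of _ m])
  next
    fix x y assume "x \<in> H" "y \<in> H"
    then obtain m n :: nat where x: "x \<in> carrier G" "m \<ge> 1" "x [^] m \<in> K"
      and y: "y \<in> carrier G" "n \<ge> 1" "y [^] n \<in> K" unfolding H_def by blast
    obtain h where h: "h \<in> carrier G" "h [^] (2::nat) = commutator G y x"
      using root_exists[of "commutator G y x" 2] x y by auto
    have hh: "h \<otimes> h = commutator G y x" using h by (simp add: numeral_2_eq_2)
    have com: "h \<otimes> w = w \<otimes> h" if "w = x \<or> w = y" for w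
      by (rule commutes_root[of h 2]) (use that h x y isolator_central(2)[OF K c y x] in auto)
    \<comment> \<open>A multiple of \<open>m\<close> and of \<open>n\<close>, with a factor 2 for
      the square root: \<open>k * (k - 1)\<close> is a multiple of \<open>2 * (n * m)\<close>, and
      \<open>h [^] (2 * (n * m))\<close> is a power of the commutator that lies in
      \<open>K\<close>.\<close>
    define k where "k = m * n * 2"
    have "h [^] (2 * (n * m)) \<in> K"
      using isolator_central(1)[OF K c y x] h by (simp flip: nat_pow_pow)
    then have "h [^] (k * (k - 1)) \<in> K"
      using Kpow[of h "2 * (n * m)" "k - 1"] h(1) by (simp add: k_def mult.commute)
    moreover have "x [^] k \<in> K" "y [^] k \<in> K"
      using Kpow[of x m "n * 2"] Kpow[of y n "m * 2"] x y by (simp_all add: k_def ac_simps)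
    moreover have "(x \<otimes> y) [^] k = x [^] k \<otimes> y [^] k \<otimes> h [^] (k * (k - 1))"
      by (rule pow_mult_commutator_root)
        (use x y h com hh mult_eq_commutator_mult[of y x] in auto)
    ultimately have "(x \<otimes> y) [^] k \<in> K" by simp
    then show "x \<otimes> y \<in> H" unfolding H_def using x y by (auto simp: k_def intro!: exI[of _ k])
  qed
  have Hi: "inv\<^bsub>G\<lparr>carrier := H\<rparr>\<^esub> x = inv x" if "x \<in> H" for x
    using m_inv_consistent[OF H that] .
  have "commutator (G\<lparr>carrier := H\<rparr>) x y = commutator G x y" if "x \<in> H" "y \<in> H" for x y
    using that by (simp add: commutator_def Hi)
  moreover have "commutator G x y \<in> H" if "x \<in> H" "y \<in> H" for x y
    using that subgroup.m_closed[OF H] subgroup.m_inv_closed[OF H] by (simp add: commutator_def)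
  moreover have "commutator G x y \<otimes> z = z \<otimes> commutator G x y" if "x \<in> H" "y \<in> H" "z \<in> H" for x y z
    using isolator_central(2)[OF K c] that unfolding H_def by blast
  ultimately show "central_commutators (G\<lparr>carrier := H\<rparr>)"
    by (simp add: central_commutators_def center_def)
  show "unique_root_group (G\<lparr>carrier := H\<rparr>)"
  proof (rule unique_root_subgroup[OF H])
    fix x and n :: nat assume x: "x \<in> carrier G" "n \<ge> 1" "x [^] n \<in> H"
    then obtain m where "m \<ge> (1::nat)" "x [^] (n * m) \<in> K" unfolding H_def by (auto simp: nat_pow_pow)
    then show "x \<in> H" unfolding H_def using x by (auto intro!: exI[of _ "n * m"])
  qed
qed

end

text \<open>Minimality is applied to the isolator \<open>H\<close> of the image of \<open>G\<close>.
  Its torsion freeness comes from uniqueness of roots, its nilpotency from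
  \<open>lower_central_2_iff\<close>; both claims are then properties of
  \<open>H = carrier R\<close>.\<close>

lemma maltsev_completion_class_two:
  fixes G :: "('a, 'm) monoid_scheme" and R :: "('b, 'n) monoid_scheme"
  assumes G: "group G" "central_commutators G" and M: "maltsev_completion G R \<iota>"
  shows "central_commutators R"
    and "x \<in> carrier R \<Longrightarrow> \<exists>m::nat. m \<ge> 1 \<and> x [^]\<^bsub>R\<^esub> m \<in> \<iota> ` carrier G"
proof -
  interpret G: group G by (rule G)
  have R: "complete_tfn_group R" and \<iota>: "\<iota> \<in> hom G R"
    and minimal: "\<And>H. \<lbrakk>subgroup H R; \<iota> ` carrier G \<subseteq> H; complete_tfn_group (R\<lparr>carrier := H\<rparr>)\<rbrakk>
      \<Longrightarrow> H = carrier R"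
    using M unfolding maltsev_completion_def by blast+
  interpret R: unique_root_group R
    using R by (simp add: complete_tfn_group_def unique_root_group_def unique_root_group_axioms_def)
  interpret \<iota>: group_hom G R \<iota>
    by unfold_locales (rule \<iota>)
  let ?K = "\<iota> ` carrier G"
  have K: "subgroup ?K R" by (rule \<iota>.img_is_subgroup)
  have c: "commutator R x y \<otimes>\<^bsub>R\<^esub> z = z \<otimes>\<^bsub>R\<^esub> commutator R x y"
    if xyz: "x \<in> ?K" "y \<in> ?K" "z \<in> ?K" for x y z
  proof -
    obtain a where a: "a \<in> carrier G" "x = \<iota> a" using xyz(1) by blast
    obtain b where b: "b \<in> carrier G" "y = \<iota> b" using xyz(2) by blast
    obtain d where d: "d \<in> carrier G" "z = \<iota> d" using xyz(3) by blast
    have "commutator R x y = \<iota> (commutator G a b)"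
      using a(1) b(1) by (simp add: commutator_def a(2) b(2))
    then have "commutator R x y \<otimes>\<^bsub>R\<^esub> z = \<iota> (commutator G a b \<otimes>\<^bsub>G\<^esub> d)"
      "z \<otimes>\<^bsub>R\<^esub> commutator R x y = \<iota> (d \<otimes>\<^bsub>G\<^esub> commutator G a b)"
      using a b d by simp_all
    moreover have "commutator G a b \<otimes>\<^bsub>G\<^esub> d = d \<otimes>\<^bsub>G\<^esub> commutator G a b"
      using G.center_commutes[of "commutator G a b" d] G(2) a(1) b(1) d(1)
      by (simp add: central_commutators_def)
    ultimately show ?thesis by (simp only:)
  qed
  define H where "H = {x \<in> carrier R. \<exists>m::nat. m \<ge> 1 \<and> x [^]\<^bsub>R\<^esub> m \<in> ?K}"
  note H = R.isolator_class_two[OF K c, folded H_def]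
  interpret H: unique_root_group "R\<lparr>carrier := H\<rparr>" by (rule H(3))
  have "torsion_free (R\<lparr>carrier := H\<rparr>)"
    unfolding torsion_free_def using H.pow_eq_one by blast
  moreover have "nilpotent (R\<lparr>carrier := H\<rparr>)"
    unfolding nilpotent_def using H.lower_central_2_iff H(2) by blast
  ultimately have "complete_tfn_group (R\<lparr>carrier := H\<rparr>)"
    by (simp add: complete_tfn_group_def H.unique_roots H.is_group)
  moreover have "?K \<subseteq> H"
    unfolding H_def using subgroup.mem_carrier[OF K] by (auto intro!: exI[of _ 1])
  ultimately have HR: "H = carrier R"
    using minimal H(1) by blast
  then show "central_commutators R" using H(2) by simp
  show "x \<in> carrier R \<Longrightarrow> \<exists>m::nat. m \<ge> 1 \<and> x [^]\<^bsub>R\<^esub> m \<in> ?K"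
    using HR unfolding H_def by blast
qed


section \<open>Dilations of complete groups of class two\<close>

locale class_two_root_group = unique_root_group +
  assumes central_commutators: "central_commutators G"
begin

lemma commutator_center: "x \<in> carrier G \<Longrightarrow> y \<in> carrier G \<Longrightarrow> commutator G x y \<in> center G"
  using central_commutators by (simp add: central_commutators_def)

text \<open>Half of the Lie bracket in additive terms. Uniqueness of roots makes the choice
  unambiguous, see \<open>half_commutator_eqI\<close>.\<close>

definition half_commutator :: "'a \<Rightarrow> 'a \<Rightarrow> 'a" where
  "half_commutator x y = (SOME h. h \<in> carrier G \<and> h \<otimes> h = commutator G x y)"

lemma half_commutator_square:
  assumes "x \<in> carrier G" "y \<in> carrier G"
  shows "half_commutator x y \<in> carrier G"
    "half_commutator x y \<otimes> half_commutator x y = commutator G x y"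
proof -
  have "\<exists>h. h \<in> carrier G \<and> h \<otimes> h = commutator G x y"
    using root_exists[of "commutator G x y" 2] assms by (auto simp: numeral_2_eq_2)
  then have "half_commutator x y \<in> carrier G \<and> half_commutator x y \<otimes> half_commutator x y = commutator G x y"
    unfolding half_commutator_def by (rule someI_ex)
  then show "half_commutator x y \<in> carrier G"
    "half_commutator x y \<otimes> half_commutator x y = commutator G x y" by auto
qed

lemma half_commutator_eqI:
  "\<lbrakk>x \<in> carrier G; y \<in> carrier G; h \<in> carrier G; h \<otimes> h = commutator G x y\<rbrakk> \<Longrightarrow> half_commutator x y = h"
  using root_unique[of "half_commutator x y" h 2] half_commutator_square[of x y]
  by (simp add: numeral_2_eq_2)

lemma center_root:
  "x \<in> carrier G \<Longrightarrow> n \<ge> (1::nat) \<Longrightarrow> x [^] n \<in> center G \<Longrightarrow> x \<in> center G"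
  unfolding center_def using commutes_root[of x n] by blast

lemma half_commutator_center:
  "x \<in> carrier G \<Longrightarrow> y \<in> carrier G \<Longrightarrow> half_commutator x y \<in> center G"
  using center_root[of "half_commutator x y" 2] half_commutator_square[of x y] commutator_center
  by (simp add: numeral_2_eq_2)

lemma half_commutator_swap:
  assumes "x \<in> carrier G" "y \<in> carrier G"
  shows "half_commutator y x = inv half_commutator x y"
  using assms half_commutator_square[of x y]
  by (intro half_commutator_eqI) (auto simp: inv_commutator simp flip: inv_mult_group)

text \<open>In class two the commutator is multiplicative in each argument. The half commutators are
  central, so their product squares to the product of the commutators.\<close>

lemma half_commutator_mult_left:
  assumes x: "x \<in> carrier G" and y: "y \<in> carrier G" and z: "z \<in> carrier G"
  shows "half_commutator (x \<otimes> y) z = half_commutator x z \<otimes> half_commutator y z"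
proof (rule half_commutator_eqI)
  let ?c = "commutator G x z" and ?d = "commutator G y z"
    and ?h = "half_commutator x z" and ?k = "half_commutator y z"
  have c: "?c \<in> carrier G" "?d \<in> carrier G" "?h \<in> carrier G" "?k \<in> carrier G"
    using half_commutator_square x y z by auto
  have "x \<otimes> y \<otimes> z = x \<otimes> (?d \<otimes> (z \<otimes> y))"
    using x y z mult_eq_commutator_mult[of y z] by (simp add: m_assoc)
  also have "\<dots> = (?d \<otimes> x) \<otimes> (z \<otimes> y)"
    using x y z c center_commutes[OF commutator_center[OF y z] x] by (simp add: m_assoc)
  also have "\<dots> = ?d \<otimes> (x \<otimes> z) \<otimes> y"
    using x y z c by (simp add: m_assoc)
  also have "\<dots> = ?d \<otimes> ?c \<otimes> (z \<otimes> (x \<otimes> y))"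
    using x y z c by (subst mult_eq_commutator_mult[OF x z]) (simp add: m_assoc)
  also have "?d \<otimes> ?c = ?c \<otimes> ?d"
    using center_commutes[OF commutator_center[OF y z] c(1)] .
  finally have "commutator G (x \<otimes> y) z = ?c \<otimes> ?d"
    using x y z c by (intro commutator_eqI) auto
  also have "\<dots> = ?h \<otimes> ?h \<otimes> (?k \<otimes> ?k)"
    using half_commutator_square x y z by simp
  also have "\<dots> = ?h \<otimes> (?h \<otimes> ?k) \<otimes> ?k"
    using c by (simp add: m_assoc)
  also have "?h \<otimes> ?k = ?k \<otimes> ?h"
    using center_commutes[OF half_commutator_center[OF x z] c(4)] .
  finally show "?h \<otimes> ?k \<otimes> (?h \<otimes> ?k) = commutator G (x \<otimes> y) z"
    using c by (simp add: m_assoc)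
qed (use half_commutator_square x y z in auto)

lemma half_commutator_mult_right:
  assumes x: "x \<in> carrier G" and y: "y \<in> carrier G" and z: "z \<in> carrier G"
  shows "half_commutator z (x \<otimes> y) = half_commutator z x \<otimes> half_commutator z y"
proof -
  have c: "half_commutator x z \<in> carrier G" "half_commutator y z \<in> carrier G"
    using half_commutator_square x y z by auto
  have "half_commutator z (x \<otimes> y) = inv (half_commutator x z \<otimes> half_commutator y z)"
    using half_commutator_mult_left[OF x y z] half_commutator_swap[of "x \<otimes> y" z] x y z by simp
  also have "half_commutator x z \<otimes> half_commutator y z = half_commutator y z \<otimes> half_commutator x z"
    using center_commutes[OF half_commutator_center[OF x z] c(2)] .
  finally show ?thesis
    using half_commutator_swap[OF x z] half_commutator_swap[OF y z] c by (simp add: inv_mult_group)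
qed

lemma half_commutator_eq_one:
  "\<lbrakk>x \<in> carrier G; y \<in> carrier G; x \<otimes> y = y \<otimes> x\<rbrakk> \<Longrightarrow> half_commutator x y = \<one>"
  by (rule half_commutator_eqI) (simp_all add: commutator_eq_one_iff[THEN iffD2])

lemma half_commutator_center_arg [simp]:
  "z \<in> center G \<Longrightarrow> x \<in> carrier G \<Longrightarrow> half_commutator z x = \<one>"
  "z \<in> center G \<Longrightarrow> x \<in> carrier G \<Longrightarrow> half_commutator x z = \<one>"
  using center_commutes[of z x] center_closed[of z] by (auto intro: half_commutator_eq_one)

text \<open>The additive group of the Lie ring attached to \<open>G\<close> by the Baer correspondence
  (the Baker--Campbell--Hausdorff formula in class two).\<close>

definition baer_group :: "'a monoid" where
  "baer_group = \<lparr>carrier = carrier G, mult = (\<lambda>x y. x \<otimes> y \<otimes> half_commutator y x), one = \<one>\<rparr>"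

lemma baer_group_simps [simp]:
  "carrier baer_group = carrier G"
  "x \<otimes>\<^bsub>baer_group\<^esub> y = x \<otimes> y \<otimes> half_commutator y x"
  "\<one>\<^bsub>baer_group\<^esub> = \<one>"
  by (simp_all add: baer_group_def)

text \<open>Associativity is the cocycle identity, which follows from bilinearity and centrality of
  \<open>half_commutator\<close>. For commutativity the two halves of the commutator are distributed
  evenly over \<open>x \<otimes> y\<close> and \<open>y \<otimes> x\<close>. Inverses are those of
  \<open>G\<close>, as \<open>x\<close> commutes with \<open>inv x\<close>.\<close>

lemma comm_group_baer_group: "comm_group baer_group"
proof (rule comm_groupI)
  fix x y z assume "x \<in> carrier baer_group" "y \<in> carrier baer_group" "z \<in> carrier baer_group"
  then have x: "x \<in> carrier G" and y: "y \<in> carrier G" and z: "z \<in> carrier G" by auto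
  let ?a = "half_commutator y x" and ?b = "half_commutator z x" and ?c = "half_commutator z y"
  have cl: "?a \<in> carrier G" "?b \<in> carrier G" "?c \<in> carrier G"
    using half_commutator_square x y z by auto
  have Z: "?a \<in> center G" "?b \<in> center G" "?c \<in> center G"
    using half_commutator_center x y z by auto
  have "x \<otimes>\<^bsub>baer_group\<^esub> y \<otimes>\<^bsub>baer_group\<^esub> z = x \<otimes> y \<otimes> (?a \<otimes> z) \<otimes> (?b \<otimes> ?c)"
    using x y z cl Z by (simp add: half_commutator_mult_right m_assoc)
  also have "?a \<otimes> z = z \<otimes> ?a" using center_commutes[OF Z(1) z] .
  also have "x \<otimes> y \<otimes> (z \<otimes> ?a) \<otimes> (?b \<otimes> ?c) = x \<otimes> (y \<otimes> z) \<otimes> ((?a \<otimes> ?b) \<otimes> ?c)"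
    using x y z cl by (simp add: m_assoc)
  also have "(?a \<otimes> ?b) \<otimes> ?c = ?c \<otimes> (?a \<otimes> ?b)"
    using center_commutes[OF Z(3), of "?a \<otimes> ?b"] cl by simp
  also have "x \<otimes> (y \<otimes> z) \<otimes> (?c \<otimes> (?a \<otimes> ?b)) = x \<otimes>\<^bsub>baer_group\<^esub> (y \<otimes>\<^bsub>baer_group\<^esub> z)"
    using x y z cl Z by (simp add: half_commutator_mult_left m_assoc)
  finally show "x \<otimes>\<^bsub>baer_group\<^esub> y \<otimes>\<^bsub>baer_group\<^esub> z = x \<otimes>\<^bsub>baer_group\<^esub> (y \<otimes>\<^bsub>baer_group\<^esub> z)" .
next
  fix x y assume "x \<in> carrier baer_group" "y \<in> carrier baer_group"
  then have x: "x \<in> carrier G" and y: "y \<in> carrier G" by auto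
  let ?h = "half_commutator x y"
  have h: "?h \<in> carrier G" using half_commutator_square x y by auto
  have yx: "y \<otimes> x \<in> carrier G" using x y by simp
  have "x \<otimes> y \<otimes> inv ?h = (?h \<otimes> ?h) \<otimes> (y \<otimes> x) \<otimes> inv ?h"
    using mult_eq_commutator_mult[OF x y] half_commutator_square[OF x y] by simp
  also have "\<dots> = ?h \<otimes> ((?h \<otimes> (y \<otimes> x)) \<otimes> inv ?h)"
    using x y h by (simp add: m_assoc)
  also have "?h \<otimes> (y \<otimes> x) = y \<otimes> x \<otimes> ?h"
    using center_commutes[OF half_commutator_center[OF x y] yx] .
  also have "?h \<otimes> (y \<otimes> x \<otimes> ?h \<otimes> inv ?h) = ?h \<otimes> (y \<otimes> x)"
    using h x y by (simp add: m_assoc)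
  also have "\<dots> = y \<otimes> x \<otimes> ?h"
    using center_commutes[OF half_commutator_center[OF x y] yx] .
  finally show "x \<otimes>\<^bsub>baer_group\<^esub> y = y \<otimes>\<^bsub>baer_group\<^esub> x"
    using x y by (simp add: half_commutator_swap[of x y])
next
  fix x assume "x \<in> carrier baer_group"
  then have x: "x \<in> carrier G" by simp
  then have "half_commutator x (inv x) = \<one>" by (intro half_commutator_eq_one) auto
  with x show "\<exists>y\<in>carrier baer_group. y \<otimes>\<^bsub>baer_group\<^esub> x = \<one>\<^bsub>baer_group\<^esub>"
    by (intro bexI[of _ "inv x"]) auto
qed (simp_all add: half_commutator_square(1) subgroup.one_closed[OF subgroup_center])

text \<open>The center has unique roots, so its identity map extends to a Baer homomorphism
  \<open>p\<close> on a subgroup containing \<open>S\<close>. The half commutator in the last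
  property measures the failure of \<open>p\<close> to respect the product of
  \<open>G\<close>.\<close>

lemma baer_projection:
  assumes S: "finite S" "S \<subseteq> carrier G"
  obtains D p where "S \<subseteq> D" "center G \<subseteq> D" "D \<subseteq> carrier G"
    "\<And>x y. x \<in> D \<Longrightarrow> y \<in> D \<Longrightarrow> x \<otimes> y \<in> D"
    "\<And>x. x \<in> D \<Longrightarrow> p x \<in> center G" "\<And>z. z \<in> center G \<Longrightarrow> p z = z"
    "\<And>x y. x \<in> D \<Longrightarrow> y \<in> D \<Longrightarrow> p (x \<otimes> y) = p x \<otimes> p y \<otimes> half_commutator x y"
proof -
  interpret B: comm_group baer_group by (rule comm_group_baer_group)
  interpret Z: subgroup "center G" G by (rule subgroup_center)
  let ?Z = "G\<lparr>carrier := center G\<rparr>"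
  have "group ?Z" by (rule subgroup_imp_group[OF subgroup_center])
  then have Z1: "comm_group ?Z"
    by (rule group.group_comm_groupI) (simp add: center_commutes center_closed)
  have Z2: "unique_root_group ?Z"
    by (rule unique_root_subgroup[OF subgroup_center]) (rule center_root)
  have Z3: "subgroup (center G) baer_group"
  proof (rule B.subgroupI)
    fix z assume z: "z \<in> center G"
    then have "inv\<^bsub>baer_group\<^esub> z = inv z"
      using Z.m_inv_closed[OF z] center_closed[OF z] by (intro B.inv_equality) auto
    then show "inv\<^bsub>baer_group\<^esub> z \<in> center G" using z by simp
  next
    show "center G \<noteq> {}" using Z.one_closed by blast
  qed (use center_closed in auto)
  \<comment> \<open>On the center the half commutators vanish and the two group laws
    coincide.\<close>
  have Z4: "(\<lambda>z. z) \<in> hom (baer_group\<lparr>carrier := center G\<rparr>) ?Z"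
    using center_closed by (auto simp: hom_def)
  obtain D p where D: "subgroup D baer_group" "center G \<union> S \<subseteq> D"
    and p: "p \<in> hom (baer_group\<lparr>carrier := D\<rparr>) ?Z" "\<forall>z\<in>center G. p z = z"
    using hom_extend_finite[OF comm_group_baer_group Z1 Z2 Z3 Z4, of S] S by auto
  interpret D: subgroup D baer_group by (rule D)
  have DG: "D \<subseteq> carrier G" using D.subset by simp
  have pm: "p (x \<otimes> y \<otimes> half_commutator y x) = p x \<otimes> p y" if "x \<in> D" "y \<in> D" for x y
    using hom_mult[OF p(1), of x y] that by simp
  have pz: "p x \<in> center G" if "x \<in> D" for x
    using hom_in_carrier[OF p(1), of x] that by simp
  \<comment> \<open>This recovers the product from the Baer sum. As the correction term is central,
    hence in \<open>D\<close>, it gives both closure of \<open>D\<close> under products and the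
    formula for \<open>p\<close>.\<close>
  have split: "x \<otimes> y = (x \<otimes>\<^bsub>baer_group\<^esub> y) \<otimes>\<^bsub>baer_group\<^esub> half_commutator x y"
    if "x \<in> carrier G" "y \<in> carrier G" for x y
    using that half_commutator_square[OF that] half_commutator_center[OF that]
    by (simp add: half_commutator_swap[of x y] m_assoc)
  have H: "half_commutator x y \<in> D" "half_commutator x y \<in> center G" if "x \<in> D" "y \<in> D" for x y
    using that DG D(2) half_commutator_center[of x y] by auto
  show thesis
  proof (rule that[OF _ _ DG])
    fix x y assume xy: "x \<in> D" "y \<in> D"
    then have c: "x \<in> carrier G" "y \<in> carrier G" using DG by auto
    have m: "x \<otimes>\<^bsub>baer_group\<^esub> y \<in> D" using xy D.m_closed by blast
    show "x \<otimes> y \<in> D"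
      unfolding split[OF c] using D.m_closed[OF m H(1)[OF xy]] .
    have "p (x \<otimes> y) = p (x \<otimes>\<^bsub>baer_group\<^esub> y) \<otimes> p (half_commutator x y)"
      using split[OF c] pm[OF m H(1)[OF xy]] by simp
    then show "p (x \<otimes> y) = p x \<otimes> p y \<otimes> half_commutator x y"
      using pm[OF xy] p(2) H(2)[OF xy] by simp
  qed (use D p pz in auto)
qed

section \<open>Construction of the dilation\<close>

lemma central_pow_mult:
  "z \<in> center G \<Longrightarrow> w \<in> carrier G \<Longrightarrow> (z \<otimes> w) [^] (n::nat) = z [^] n \<otimes> w [^] n"
  using pow_mult_distrib[of z w] center_commutes center_closed by blast

text \<open>The exponents of the single elements are multiplied together. The extra factor
  \<open>j\<close> admits all multiples, which \<open>dilation\<close> uses for the exponent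
  \<open>n * (n - 1)\<close>.\<close>

lemma common_power:
  assumes K: "subgroup K G" and pow: "\<And>x. x \<in> carrier G \<Longrightarrow> \<exists>m::nat. m \<ge> 1 \<and> x [^] m \<in> K"
    and S: "finite S" "S \<subseteq> carrier G"
  shows "\<exists>n::nat. n \<ge> 1 \<and> (\<forall>x\<in>S. \<forall>j::nat. x [^] (n * j) \<in> K)"
  using S
proof (induction S)
  case (insert x S)
  interpret K: subgroup K G by (rule K)
  obtain n where n: "n \<ge> (1::nat)" "\<forall>x\<in>S. \<forall>j::nat. x [^] (n * j) \<in> K" using insert by auto
  obtain m where m: "m \<ge> (1::nat)" "x [^] m \<in> K" using pow[of x] insert.prems by auto
  have "(x [^] m) [^] (k::nat) \<in> K" for k using m(2) by (induction k) auto
  then have "x [^] (m * n * j) \<in> K" for j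
    using insert.prems by (simp add: nat_pow_pow mult.assoc)
  moreover have "y [^] (m * n * j) \<in> K" if "y \<in> S" for y j
    using n(2) that by (metis mult.assoc mult.commute)
  ultimately show ?case using n(1) m(1) by (intro exI[of _ "m * n"]) auto
qed auto

text \<open>On the Lie ring, \<open>\<delta>\<close> multiplies by \<open>n\<close> on a complement of the center (the kernel of \<open>p\<close>)
  and by \<open>n\<^sup>2\<close> on the center, hence is compatible with the bracket.\<close>

lemma dilation:
  assumes K: "subgroup K G" and pow: "\<And>x. x \<in> carrier G \<Longrightarrow> \<exists>m::nat. m \<ge> 1 \<and> x [^] m \<in> K"
    and S: "finite S" "S \<subseteq> carrier G"
  obtains D \<delta> where "S \<subseteq> D" "\<one> \<in> D" "D \<subseteq> carrier G" "\<And>x y. x \<in> D \<Longrightarrow> y \<in> D \<Longrightarrow> x \<otimes> y \<in> D"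
    "\<And>x y. x \<in> D \<Longrightarrow> y \<in> D \<Longrightarrow> \<delta> (x \<otimes> y) = \<delta> x \<otimes> \<delta> y"
    "\<And>x. x \<in> D \<Longrightarrow> \<delta> x = \<one> \<longleftrightarrow> x = \<one>" "\<delta> ` S \<subseteq> K"
proof -
  interpret K: subgroup K G by (rule K)
  interpret Z: subgroup "center G" G by (rule subgroup_center)
  obtain D p where D: "S \<subseteq> D" "center G \<subseteq> D" "D \<subseteq> carrier G"
    "\<And>x y. x \<in> D \<Longrightarrow> y \<in> D \<Longrightarrow> x \<otimes> y \<in> D"
    and p: "\<And>x. x \<in> D \<Longrightarrow> p x \<in> center G" "\<And>z. z \<in> center G \<Longrightarrow> p z = z"
    "\<And>x y. x \<in> D \<Longrightarrow> y \<in> D \<Longrightarrow> p (x \<otimes> y) = p x \<otimes> p y \<otimes> half_commutator x y"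
    by (rule baer_projection[OF S]) (rule that)
  have "p ` S \<subseteq> carrier G" using p(1) D(1) center_closed by blast
  \<comment> \<open>One exponent serves \<open>S\<close> and its image under \<open>p\<close>
    together, since \<open>\<delta>\<close> involves powers of both \<open>x\<close> and
    \<open>p x\<close>.\<close>
  then obtain n :: nat where n: "n \<ge> 1" "\<And>x j. x \<in> S \<union> p ` S \<Longrightarrow> x [^] (n * j) \<in> K"
    using common_power[OF K pow, of "S \<union> p ` S"] S by auto
  \<comment> \<open>The exponent of \<open>h\<close> in \<open>pow_mult_commutator_root\<close>. On
    the center \<open>\<delta>\<close> raises to the power \<open>n + N\<close>, which is the square
    of \<open>n\<close>.\<close>
  define N where "N = n * (n - 1)"
  define \<delta> where "\<delta> x = x [^] n \<otimes> p x [^] N" for x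
  have Zpow: "z [^] (k::nat) \<in> center G" if "z \<in> center G" for z k
    using that by (induction k) auto
  show thesis
  proof (rule that[OF D(1) _ D(3,4)])
    show "\<one> \<in> D" using D(2) Z.one_closed by blast
    fix x assume x: "x \<in> D"
    then have xc: "x \<in> carrier G" using D(3) by blast
    have px: "p x \<in> center G" "p x \<in> carrier G" using p(1)[OF x] center_closed by auto
    show "\<delta> x = \<one> \<longleftrightarrow> x = \<one>"
    proof
      assume "\<delta> x = \<one>"
      \<comment> \<open>\<open>x [^] n\<close> is the inverse of a central element, so
        \<open>x\<close> is central by \<open>center_root\<close>; then \<open>p x = x\<close> and
        \<open>\<delta> x = x [^] (n + N)\<close>.\<close>
      then have "x [^] n = inv (p x [^] N)"
        unfolding \<delta>_def using xc px by (simp add: inv_equality)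
      then have "x [^] n \<in> center G" using Zpow[OF px(1), of N] by simp
      then have "x \<in> center G" using center_root[OF xc n(1)] by simp
      then have "x [^] (n + N) = \<one>"
        using \<open>\<delta> x = \<one>\<close> p(2) xc unfolding \<delta>_def by (simp add: nat_pow_mult)
      then show "x = \<one>" using pow_eq_one[OF xc, of "n + N"] n(1) by simp
    qed (use p(2) Z.one_closed in \<open>auto simp: \<delta>_def\<close>)
    fix y assume y: "y \<in> D"
    then have yc: "y \<in> carrier G" using D(3) by blast
    have py: "p y \<in> center G" "p y \<in> carrier G" using p(1)[OF y] center_closed by auto
    let ?h = "half_commutator y x"
    have h: "?h \<in> carrier G" "?h \<in> center G" "?h \<otimes> ?h = commutator G y x"
      using half_commutator_square half_commutator_center xc yc by auto
    have 1: "(x \<otimes> y) [^] n = x [^] n \<otimes> y [^] n \<otimes> ?h [^] N"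
      unfolding N_def
      by (rule pow_mult_commutator_root)
        (use xc yc h mult_eq_commutator_mult[of y x] center_commutes in auto)
    have ppc: "p x \<otimes> p y \<in> center G" using px py by simp
    have "p (x \<otimes> y) [^] N = (p x \<otimes> p y) [^] N \<otimes> inv ?h [^] N"
      using p(3)[OF x y] half_commutator_swap[OF yc xc] central_pow_mult[OF ppc, of "inv ?h"] h
      by simp
    also have "\<dots> = p x [^] N \<otimes> p y [^] N \<otimes> inv (?h [^] N)"
      using central_pow_mult[OF px(1) py(2)] h by (simp add: nat_pow_inv)
    finally have 2: "p (x \<otimes> y) [^] N = inv (?h [^] N) \<otimes> (p x [^] N \<otimes> p y [^] N)"
      using center_commutes[OF Z.m_inv_closed[OF Zpow[OF h(2)]]] px py by simp
    \<comment> \<open>The factor \<open>?h [^] N\<close> from \<open>1\<close> and its inverse from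
      \<open>2\<close> cancel; this is what fixes the choice of \<open>N\<close>.\<close>
    have "\<delta> (x \<otimes> y) = x [^] n \<otimes> (y [^] n \<otimes> p x [^] N) \<otimes> p y [^] N"
      unfolding \<delta>_def 1 2 using xc yc h px py
      by (simp add: m_assoc inv_solve_left) (simp flip: m_assoc)
    also have "y [^] n \<otimes> p x [^] N = p x [^] N \<otimes> y [^] n"
      using center_commutes[OF Zpow[OF px(1)]] yc by simp
    finally show "\<delta> (x \<otimes> y) = \<delta> x \<otimes> \<delta> y"
      unfolding \<delta>_def using xc yc px py by (simp add: m_assoc)
  next
    have "\<delta> x \<in> K" if "x \<in> S" for x
      \<comment> \<open>The multiplier is 1 for the power of \<open>x\<close> and
        \<open>n - 1\<close> for the power of \<open>p x\<close>.\<close>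
      using n(2)[of x 1] n(2)[of "p x" "n - 1"] that unfolding \<delta>_def N_def by simp
    then show "\<delta> ` S \<subseteq> K" by blast
  qed
qed

end

section \<open>Comparison of the kernels of homomorphisms into \<open>G\<close> and into
  \<open>R\<close>\<close>

theorem theorem1:
  fixes G :: "('a, 'm) monoid_scheme"
    and R :: "('b, 'n) monoid_scheme"
    and \<iota> :: "'a \<Rightarrow> 'b"
    and \<Theta> :: "nat word set"
  assumes "group G" and "torsion_free G" and "nilpotent G" and "nilpotency_class G = 2"
    and "maltsev_completion G R \<iota>"
    and "in_variety \<Theta> G" and "in_variety \<Theta> R"
  shows "geometrically_equivalent \<Theta> G R"
proof -
  interpret G: group G by fact
  \<comment> \<open>Nilpotency ensures that the least index defining \<open>nilpotency_class\<close>
    is attained.\<close>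
  have "lower_central G 2 = {\<one>\<^bsub>G\<^esub>}"
    using LeastI_ex[OF assms(3)[unfolded nilpotent_def]]
    unfolding assms(4)[unfolded nilpotency_class_def] .
  then have G2: "central_commutators G" by (simp add: G.lower_central_2_iff)
  note M = maltsev_completion_class_two[OF assms(1) G2 assms(5)]
  have R: "complete_tfn_group R" and \<iota>: "\<iota> \<in> hom G R" and inj: "inj_on \<iota> (carrier G)"
    using assms(5) unfolding maltsev_completion_def by blast+
  interpret R: class_two_root_group R
    using R M(1)
    by (simp add: class_two_root_group_def class_two_root_group_axioms_def unique_root_group_def
        unique_root_group_axioms_def complete_tfn_group_def)
  interpret \<iota>: group_hom G R \<iota>
    by unfold_locales (rule \<iota>)
  have K: "subgroup (\<iota> ` carrier G) R" by (rule \<iota>.img_is_subgroup)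
  show ?thesis
    unfolding geometrically_equivalent_def
  proof (intro allI impI)
    fix X :: "nat set" and T assume X: "finite X"
    let ?W = "variety_free_group \<Theta> X"
    have GR: "\<exists>\<nu>\<in>hom ?W R. kernel ?W R \<nu> = kernel ?W G \<mu>" if \<mu>: "\<mu> \<in> hom ?W G" for \<mu>
    proof
      show "\<iota> \<circ> \<mu> \<in> hom ?W R" using hom_compose[OF \<mu> \<iota>.homh] .
      have "\<iota> (\<mu> w) = \<one>\<^bsub>R\<^esub> \<longleftrightarrow> \<mu> w = \<one>\<^bsub>G\<^esub>" if "w \<in> carrier ?W" for w
        using inj_onD[OF inj, of "\<mu> w" "\<one>\<^bsub>G\<^esub>"] hom_in_carrier[OF \<mu> that] by auto
      then show "kernel ?W R (\<iota> \<circ> \<mu>) = kernel ?W G \<mu>" by (auto simp: kernel_def)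
    qed
    have RG: "\<exists>\<mu>\<in>hom ?W G. kernel ?W G \<mu> = kernel ?W R \<nu>" if \<nu>: "\<nu> \<in> hom ?W R" for \<nu>
    proof -
      obtain S where S: "finite S" "S \<subseteq> carrier R"
        "\<And>E. \<lbrakk>\<one>\<^bsub>R\<^esub> \<in> E; S \<subseteq> E; \<forall>a\<in>E. \<forall>b\<in>E. a \<otimes>\<^bsub>R\<^esub> b \<in> E\<rbrakk>
          \<Longrightarrow> \<nu> ` carrier ?W \<subseteq> E"
        by (rule variety_free_group_hom_image[OF X R.is_group \<nu>]) (rule that)
      obtain D \<delta> where D: "S \<subseteq> D" "\<one>\<^bsub>R\<^esub> \<in> D" "D \<subseteq> carrier R"
          "\<And>x y. x \<in> D \<Longrightarrow> y \<in> D \<Longrightarrow> x \<otimes>\<^bsub>R\<^esub> y \<in> D"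
        and \<delta>: "\<And>x y. x \<in> D \<Longrightarrow> y \<in> D \<Longrightarrow> \<delta> (x \<otimes>\<^bsub>R\<^esub> y) = \<delta> x \<otimes>\<^bsub>R\<^esub> \<delta> y"
          "\<And>x. x \<in> D \<Longrightarrow> \<delta> x = \<one>\<^bsub>R\<^esub> \<longleftrightarrow> x = \<one>\<^bsub>R\<^esub>" "\<delta> ` S \<subseteq> \<iota> ` carrier G"
        by (rule R.dilation[OF K M(2) S(1,2)]) (assumption, rule that)
      \<comment> \<open>The set on the right contains the identity and \<open>S\<close> and is
        closed under products, which is all that the choice of \<open>S\<close> asks for.\<close>
      have "\<nu> ` carrier ?W \<subseteq> {x \<in> D. \<delta> x \<in> \<iota> ` carrier G}"
      proof (rule S(3))
        have "\<delta> \<one>\<^bsub>R\<^esub> = \<one>\<^bsub>R\<^esub>" using \<delta>(2) D(2) by blast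
        then show "\<one>\<^bsub>R\<^esub> \<in> {x \<in> D. \<delta> x \<in> \<iota> ` carrier G}"
          using D(2) subgroup.one_closed[OF K] by simp
        show "S \<subseteq> {x \<in> D. \<delta> x \<in> \<iota> ` carrier G}" using D(1) \<delta>(3) by blast
        show "\<forall>a\<in>{x \<in> D. \<delta> x \<in> \<iota> ` carrier G}. \<forall>b\<in>{x \<in> D. \<delta> x \<in> \<iota> ` carrier G}.
            a \<otimes>\<^bsub>R\<^esub> b \<in> {x \<in> D. \<delta> x \<in> \<iota> ` carrier G}"
          using D(4) \<delta>(1) subgroup.m_closed[OF K] by simp
      qed
      then have \<nu>D: "\<nu> w \<in> D" "\<delta> (\<nu> w) \<in> \<iota> ` carrier G" if "w \<in> carrier ?W" for w
        using that by auto
      \<comment> \<open>\<open>\<delta> \<circ> \<nu>\<close> lands in the image of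
        \<open>\<iota>\<close>, so it can be pulled back to \<open>G\<close>; the kernel stays the
        same because \<open>\<delta>\<close> has trivial kernel on \<open>D\<close>.\<close>
      define \<mu> where "\<mu> w = inv_into (carrier G) \<iota> (\<delta> (\<nu> w))" for w
      have \<mu>: "\<mu> w \<in> carrier G" "\<iota> (\<mu> w) = \<delta> (\<nu> w)" if "w \<in> carrier ?W" for w
        using \<nu>D(2)[OF that] by (auto simp: \<mu>_def inv_into_into f_inv_into_f)
      show ?thesis
      proof
        show "\<mu> \<in> hom ?W G"
        proof (rule homI)
          fix v w assume vw: "v \<in> carrier ?W" "w \<in> carrier ?W"
          have "\<mu> (v \<otimes>\<^bsub>?W\<^esub> w) = inv_into (carrier G) \<iota> (\<delta> (\<nu> v) \<otimes>\<^bsub>R\<^esub> \<delta> (\<nu> w))"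
            using vw \<nu>D hom_mult[OF \<nu>] \<delta>(1) by (simp add: \<mu>_def)
          also have "\<dots> = inv_into (carrier G) \<iota> (\<iota> (\<mu> v \<otimes>\<^bsub>G\<^esub> \<mu> w))"
            using vw \<mu> by simp
          also have "\<dots> = \<mu> v \<otimes>\<^bsub>G\<^esub> \<mu> w"
            by (rule inv_into_f_f[OF inj]) (use vw \<mu>(1) in simp)
          finally show "\<mu> (v \<otimes>\<^bsub>?W\<^esub> w) = \<mu> v \<otimes>\<^bsub>G\<^esub> \<mu> w" .
        qed (rule \<mu>)
        have "\<mu> w = \<one>\<^bsub>G\<^esub> \<longleftrightarrow> \<nu> w = \<one>\<^bsub>R\<^esub>" if "w \<in> carrier ?W" for w
          using inj_onD[OF inj, of "\<mu> w" "\<one>\<^bsub>G\<^esub>"] \<mu>[OF that] \<delta>(2)[OF \<nu>D(1)[OF that]] by auto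
        then show "kernel ?W G \<mu> = kernel ?W R \<nu>" by (auto simp: kernel_def)
      qed
    qed
    \<comment> \<open>The closure is an intersection of kernels, and the condition on
      \<open>T\<close> also sees only the kernel, so equal families of kernels suffice.\<close>
    have "kernel ?W G ` killing_homs ?W G T = kernel ?W R ` killing_homs ?W R T"
    proof (intro equalityI subsetI)
      fix k assume "k \<in> kernel ?W G ` killing_homs ?W G T"
      then obtain \<mu> where "\<mu> \<in> hom ?W G" "T \<subseteq> k" "k = kernel ?W G \<mu>"
        by (auto simp: killing_homs_def)
      with GR[of \<mu>] show "k \<in> kernel ?W R ` killing_homs ?W R T"
        by (auto simp: killing_homs_def)
    next
      fix k assume "k \<in> kernel ?W R ` killing_homs ?W R T"
      then obtain \<nu> where "\<nu> \<in> hom ?W R" "T \<subseteq> k" "k = kernel ?W R \<nu>"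
        by (auto simp: killing_homs_def)
      with RG[of \<nu>] show "k \<in> kernel ?W G ` killing_homs ?W G T"
        by (auto simp: killing_homs_def)
    qed
    then show "geometric_closure ?W G T = geometric_closure ?W R T"
      by (simp add: geometric_closure_def)
  qed
qed

end
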